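(* Let $b_0,b_1,\ldots$ and $\lambda_1,\lambda_2,\ldots$ be independent indeterminates and let $R=\mathbb{Z}[b,b^{-1},\lambda]$ be the ring of polynomials in the $\lambda_k$ and Laurent polynomials in the $b_k$. Define $\mu_m\in R$ for all integers $m$ as follows: for $m\geq 0$, $\mu_m=\sum_\omega \mathrm{wt}(\omega)$ over all Schröder paths $\omega$ ending at $(m,0)$; for $m\geq 1$, $\mu_{-m}=\sum_\omega \overline{\mathrm{wt}}(\omega)$ over all Schröder paths $\omega$ ending at $(m,0)$ whose first step is an $E$ step. Then for every $n\geq 0$ the Toeplitz matrix $(\mu_{i-j})_{0\leq i,j\leq n}$ has special Smith normal form $$\mathrm{diag}\Big(1,-\frac{\lambda_1}{b_1},\frac{\lambda_1\lambda_2}{b_1b_2},\ldots,(-1)^n\frac{\lambda_1\lambda_2\cdots\lambda_n}{b_1b_2\cdots b_n}\Big)$$ over $R$.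
   Context: A Schröder path is a lattice path starting at the origin $(0,0)$, ending on the $x$-axis, never going below the $x$-axis, each step of which is one of: $NE:(x,k)\to(x+1/2,k+1)$; $E:(x,k)\to(x+1,k)$; $SE:(x,k)\to(x+1/2,k-1)$. Step weights: $\mathrm{wt}(NE)=1$, $\mathrm{wt}$ of an $E$ step at height $k$ is $1/b_k$, $\mathrm{wt}$ of an $SE$ step from height $k$ to $k-1$ is $\lambda_k/(b_{k-1}b_k)$; and $\overline{\mathrm{wt}}(NE)=1$, $\overline{\mathrm{wt}}$ of an $E$ step at height $k$ is $b_k$, $\overline{\mathrm{wt}}$ of an $SE$ step from height $k$ is $\lambda_k$. The weight of a path is the product of the weights of its steps (the empty path has weight $1$). (These $\mu_m$ are the moments $\mathcal L(z^m)$ of the linear functional $\mathcal L$ on $R[z,z^{-1}]$ with $\mathcal L(1)=1$ and $\mathcal L(z^m q_n(1/z))=0$ for $0\leq m<n$, where $q_{n+1}(z)=(z-b_n)q_n(z)-z\lambda_nq_{n-1}(z)$, $q_{-1}=0$, $q_0=1$.) For an $m\times n$ matrix $A$ over a commutative ring $R$, a matrix $D$ is a special Smith normal form (SSNF) of $A$ over $R$ if there exist $P\in \mathrm{SL}(m,R)$, $Q\in\mathrm{SL}(n,R)$ with $PAQ=D$, $D$ is diagonal, and $d_{ii}$ is a multiple in $R$ of $d_{jj}$ whenever $i\geq j$. *)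

theory Defs
  imports
    "Jordan_Normal_Form.Determinant"
    "HOL-Library.Poly_Mapping"
    "HOL-Library.Product_Plus"
begin

text \<open>The ring \<open>\<int>[b, b\<^sup>-\<^sup>1, \<lambda>]\<close> is the monoid algebra over the integers of the group of
  Laurent monomials in the \<open>b\<^sub>k\<close> (\<open>k \<ge> 0\<close>, finitely many nonzero integer exponents)
  times the monoid of monomials in the \<open>\<lambda>\<^sub>k\<close> (\<open>k \<ge> 1\<close>). Multiplication of finitely supported
  functions is convolution.
  There is no \<open>\<lambda>\<^sub>0\<close>: the exponent of \<open>\<lambda>\<^sub>k\<close> sits at position \<open>k - 1\<close>, and
  \<open>lam 0\<close> is a junk value that the statement never uses.\<close>

type_synonym R = "((nat \<Rightarrow>\<^sub>0 int) \<times> (nat \<Rightarrow>\<^sub>0 nat)) \<Rightarrow>\<^sub>0 int"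

definition b_gen :: "nat \<Rightarrow> R" where
  "b_gen k = Poly_Mapping.single (Poly_Mapping.single k 1, 0) 1"

definition b_inv :: "nat \<Rightarrow> R" where
  "b_inv k = Poly_Mapping.single (Poly_Mapping.single k (- 1), 0) 1"

definition lam :: "nat \<Rightarrow> R" where
  "lam k = Poly_Mapping.single (0, Poly_Mapping.single (k - 1) 1) 1"

lemma b_gen_b_inv: "b_gen k * b_inv k = 1"
  unfolding b_gen_def b_inv_def
  by (simp add: mult_single single_add[symmetric] zero_prod_def[symmetric])

datatype step = NE | E | SE

text \<open>A path is the list of its steps. Heights are natural numbers, so that a path never
  goes below the horizontal axis; abscissas are rational because of the half steps.\<close>

inductive lattice_path :: "rat \<times> nat \<Rightarrow> step list \<Rightarrow> rat \<times> nat \<Rightarrow> bool" where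
  Nil: "lattice_path p [] p"
| NE: "lattice_path (x + 1/2, k + 1) w q \<Longrightarrow> lattice_path (x, k) (NE # w) q"
| E: "lattice_path (x + 1, k) w q \<Longrightarrow> lattice_path (x, k) (E # w) q"
| SE: "lattice_path (x + 1/2, k) w q \<Longrightarrow> lattice_path (x, k + 1) (SE # w) q"

definition schroeder_paths :: "nat \<Rightarrow> step list set" where
  "schroeder_paths m = {w. lattice_path (0, 0) w (of_nat m, 0)}"

lemma lattice_path_length:
  "lattice_path p w q \<Longrightarrow> of_nat (length w) \<le> 2 * (fst q - fst p)"
  by (induction rule: lattice_path.induct) auto

lemma finite_schroeder_paths: "finite (schroeder_paths m)"
proof (rule finite_subset)
  show "schroeder_paths m \<subseteq> {w. set w \<subseteq> {NE, E, SE} \<and> length w \<le> 2 * m}"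
  proof
    fix w assume "w \<in> schroeder_paths m"
    then have "(of_nat (length w) :: rat) \<le> of_nat (2 * m)"
      using lattice_path_length unfolding schroeder_paths_def by fastforce
    moreover have "set w \<subseteq> {NE, E, SE}"
      using step.exhaust by blast
    ultimately show "w \<in> {w. set w \<subseteq> {NE, E, SE} \<and> length w \<le> 2 * m}"
      by (simp only: of_nat_le_iff mem_Collect_eq)
  qed
  show "finite {w. set w \<subseteq> {NE, E, SE} \<and> length w \<le> 2 * m}"
    by (rule finite_lists_length_le) simp
qed

text \<open>Step weights; the second argument is the height at which the step starts.\<close>

fun wt :: "step \<Rightarrow> nat \<Rightarrow> R" where
  "wt NE k = 1"
| "wt E k = b_inv k"
| "wt SE k = lam k * (b_inv (k - 1) * b_inv k)"

fun wt_bar :: "step \<Rightarrow> nat \<Rightarrow> R" where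
  "wt_bar NE k = 1"
| "wt_bar E k = b_gen k"
| "wt_bar SE k = lam k"

fun next_height :: "step \<Rightarrow> nat \<Rightarrow> nat" where
  "next_height NE k = k + 1"
| "next_height E k = k"
| "next_height SE k = k - 1"

fun path_weight :: "(step \<Rightarrow> nat \<Rightarrow> R) \<Rightarrow> nat \<Rightarrow> step list \<Rightarrow> R" where
  "path_weight f k [] = 1"
| "path_weight f k (s # w) = f s k * path_weight f (next_height s k) w"

definition \<mu> :: "int \<Rightarrow> R" where
  "\<mu> m = (if m \<ge> 0 then \<Sum>w \<in> schroeder_paths (nat m). path_weight wt 0 w
    else \<Sum>w \<in> {w \<in> schroeder_paths (nat (- m)). \<exists>v. w = E # v}. path_weight wt_bar 0 w)"

definition special_linear :: "nat \<Rightarrow> 'a :: comm_ring_1 mat set" where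
  "special_linear n = {P \<in> carrier_mat n n. det P = 1}"

definition is_SSNF :: "'a :: comm_ring_1 mat \<Rightarrow> 'a mat \<Rightarrow> bool" where
  "is_SSNF A D \<longleftrightarrow>
    (\<exists>P \<in> special_linear (dim_row A). \<exists>Q \<in> special_linear (dim_col A). P * A * Q = D) \<and>
    diagonal_mat D \<and>
    (\<forall>i j. i < min (dim_row D) (dim_col D) \<longrightarrow> j \<le> i \<longrightarrow> D $$ (j, j) dvd D $$ (i, i))"

end

theory Submission
  imports Defs
begin

text \<open>
  Write \<open>\<mu>\<^sub>i = \<L>(z\<^sup>i)\<close> and let \<open>q\<^sub>n\<close> be the monic Laurent biorthogonal polynomials,
  \<open>q\<^sub>n\<^sub>+\<^sub>1(z) = (z - b\<^sub>n) q\<^sub>n(z) - z \<lambda>\<^sub>n q\<^sub>n\<^sub>-\<^sub>1(z)\<close>. Multiplying the Toeplitz matrix on the right by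
  the unitriangular matrix of coefficients of the \<open>q\<^sub>n\<close> yields the matrix of the
  \<open>G(i, n) = \<L>(z\<^sup>i q\<^sub>n(1/z))\<close>. These numbers are determined by \<open>G(i, 0) = \<mu>\<^sub>i\<close> and
  \<open>G(i, n + 1) = G(i - 1, n) - b\<^sub>n G(i, n) - \<lambda>\<^sub>n G(i - 1, n - 1)\<close>. Up to the factor
  \<open>(- 1)\<^sup>n b\<^sub>0 \<dots> b\<^sub>n\<^sub>-\<^sub>1\<close> for \<open>i \<ge> 0\<close>, or \<open>b\<^sub>0\<close> for \<open>i < 0\<close>, this is the first-step recursion
  of paths from height \<open>n\<close> to height \<open>0\<close>, with weights \<open>wt\<close> and \<open>wt_bar\<close> respectively. In the
  first case the horizontal length is \<open>i - n/2\<close>, so such a path needs \<open>i \<ge> n\<close>, and it has to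
  descend from each height \<open>k \<le> n\<close> to \<open>k - 1\<close>; hence \<open>G\<close> is lower triangular and its column
  \<open>n\<close> is divisible by the diagonal entry. A unitriangular factor on the left finishes the proof.
\<close>

section \<open>First-step analysis of lattice paths\<close>

lemma lattice_path_translate:
  "lattice_path p w q \<Longrightarrow> lattice_path (fst p + c, snd p) w (fst q + c, snd q)"
proof (induction rule: lattice_path.induct)
  case (NE x k w q)
  have "x + 1 / 2 + c = x + c + 1 / 2" by simp
  with NE.IH show ?case by (simp only: fst_conv snd_conv lattice_path.NE)
next
  case (E x k w q)
  have "x + 1 + c = x + c + 1" by simp
  with E.IH show ?case by (simp only: fst_conv snd_conv lattice_path.E)
next
  case (SE x k w q)
  have "x + 1 / 2 + c = x + c + 1 / 2" by simp
  with SE.IH show ?case by (simp only: fst_conv snd_conv lattice_path.SE)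
qed (auto intro: lattice_path.intros)

text \<open>An SE step loses height fastest, one unit per half unit of length. This slope bound
  makes path sums vanish and hence \<open>G\<close> triangular.\<close>

lemma lattice_path_height:
  "lattice_path p w q \<Longrightarrow> of_nat (snd p) \<le> of_nat (snd q) + 2 * (fst q - fst p)"
  by (induction rule: lattice_path.induct) auto

lemma lattice_path_Nil_iff [simp]: "lattice_path p [] q \<longleftrightarrow> p = q"
  by (auto elim: lattice_path.cases intro: lattice_path.intros)

lemma lattice_path_Cons_iff:
  "lattice_path (x, k) (s # w) q \<longleftrightarrow>
    (case s of NE \<Rightarrow> lattice_path (x + 1/2, k + 1) w q
      | E \<Rightarrow> lattice_path (x + 1, k) w q
      | SE \<Rightarrow> k > 0 \<and> lattice_path (x + 1/2, k - 1) w q)"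
proof (cases s)
  case SE
  have "lattice_path (x, k) (SE # w) q" if "k > 0" "lattice_path (x + 1/2, k - 1) w q"
    using lattice_path.SE[of x "k - 1" w q] that by simp
  then show ?thesis
    using SE by (auto elim: lattice_path.cases)
qed (auto elim: lattice_path.cases intro: lattice_path.intros)

text \<open>The endpoint is fixed at the origin and the start varies, so that deleting the first
  step stays within the family; \<open>d\<close> is the remaining horizontal distance.\<close>

definition descents :: "rat \<Rightarrow> nat \<Rightarrow> step list set" where
  "descents d k = {w. lattice_path (- d, k) w (0, 0)}"

lemma finite_descents: "finite (descents d k)"
proof (rule finite_subset)
  show "descents d k \<subseteq> {w. set w \<subseteq> {NE, E, SE} \<and> length w \<le> nat \<lceil>2 * d\<rceil>}"
  proof
    fix w assume "w \<in> descents d k"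
    then have "(of_nat (length w) :: rat) \<le> 2 * d"
      using lattice_path_length unfolding descents_def by fastforce
    moreover have "set w \<subseteq> {NE, E, SE}"
      using step.exhaust by blast
    ultimately show "w \<in> {w. set w \<subseteq> {NE, E, SE} \<and> length w \<le> nat \<lceil>2 * d\<rceil>}"
      by (simp; linarith)
  qed
  show "finite {w. set w \<subseteq> {NE, E, SE} \<and> length w \<le> nat \<lceil>2 * d\<rceil>}"
    by (rule finite_lists_length_le) simp
qed

lemma schroeder_paths_eq_descents: "schroeder_paths m = descents (of_nat m) 0"
  using lattice_path_translate[of "(0, 0)" _ "(of_nat m, 0)" "- of_nat m"]
    lattice_path_translate[of "(- of_nat m, 0)" _ "(0, 0)" "of_nat m"]
  by (auto simp: schroeder_paths_def descents_def)

lemma descents_eq: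
  "descents d k =
    (if d = 0 \<and> k = 0 then {[]} else {}) \<union>
    ((#) NE ` descents (d - 1/2) (k + 1) \<union>
    ((#) E ` descents (d - 1) k \<union>
     (if k > 0 then (#) SE ` descents (d - 1/2) (k - 1) else {})))" (is "_ = ?rhs")
proof (rule Set.set_eqI)
  fix w
  have "- (d - 1/2) = - d + 1/2" "- (d - 1) = - d + 1" by simp_all
  then show "w \<in> descents d k \<longleftrightarrow> w \<in> ?rhs"
    by (cases w) (auto simp only: descents_def lattice_path_Cons_iff lattice_path_Nil_iff
        mem_Collect_eq Un_iff image_iff step.case list.inject prod.inject neg_equal_0_iff_equal
        list.distinct step.distinct singleton_iff empty_iff simp_thms split: step.splits if_splits)
qed

lemma descents_empty: "2 * d < of_nat k \<Longrightarrow> descents d k = {}"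
  using lattice_path_height[of "(- d, k)" _ "(0, 0)"] by (force simp: descents_def)

section \<open>Path sums and their recursions\<close>

definition descent_sum :: "(step \<Rightarrow> nat \<Rightarrow> R) \<Rightarrow> rat \<Rightarrow> nat \<Rightarrow> R" where
  "descent_sum f d k = (\<Sum>w \<in> descents d k. path_weight f k w)"

lemma descent_sum_eq_0: "2 * d < of_nat k \<Longrightarrow> descent_sum f d k = 0"
  by (simp add: descent_sum_def descents_empty)

lemma descent_sum_rec:
  "descent_sum f d k =
    (if d = 0 \<and> k = 0 then 1 else 0) +
    f NE k * descent_sum f (d - 1/2) (k + 1) +
    f E k * descent_sum f (d - 1) k +
    (if k > 0 then f SE k * descent_sum f (d - 1/2) (k - 1) else 0)"
proof -
  let ?S0 = "if d = 0 \<and> k = 0 then {[]} else {}"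
  let ?S1 = "(#) NE ` descents (d - 1/2) (k + 1)" and ?S2 = "(#) E ` descents (d - 1) k"
  let ?S3 = "if k > 0 then (#) SE ` descents (d - 1/2) (k - 1) else {}"
  let ?g = "path_weight f k"
  have img: "sum ?g ((#) s ` S) = f s k * (\<Sum>w \<in> S. path_weight f (next_height s k) w)" for s S
    by (subst sum.reindex) (auto simp: inj_on_def sum_distrib_left)
  have fin: "finite ?S0" "finite ?S1" "finite ?S2" "finite ?S3"
    by (simp_all add: finite_descents)
  have disj: "?S0 \<inter> (?S1 \<union> (?S2 \<union> ?S3)) = {}" "?S1 \<inter> (?S2 \<union> ?S3) = {}" "?S2 \<inter> ?S3 = {}"
    by auto
  have "descent_sum f d k = sum ?g (?S0 \<union> (?S1 \<union> (?S2 \<union> ?S3)))"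
    unfolding descent_sum_def descents_eq[of d k] ..
  also have "\<dots> = sum ?g ?S0 + (sum ?g ?S1 + (sum ?g ?S2 + sum ?g ?S3))"
    by (simp only: sum.union_disjoint fin disj finite_Un simp_thms)
  also have "sum ?g ?S0 = (if d = 0 \<and> k = 0 then 1 else 0)"
    by simp
  also have "sum ?g ?S1 = f NE k * descent_sum f (d - 1/2) (k + 1)"
    by (simp add: img descent_sum_def)
  also have "sum ?g ?S2 = f E k * descent_sum f (d - 1) k"
    by (simp add: img descent_sum_def)
  also have "sum ?g ?S3 = (if k > 0 then f SE k * descent_sum f (d - 1/2) (k - 1) else 0)"
    by (simp add: img descent_sum_def)
  finally show ?thesis by (simp only: add.assoc)
qed

text \<open>With distance \<open>i - n/2\<close>, an NE step keeps \<open>i\<close>, an E step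
  lowers it, and an SE step lowers \<open>i\<close> and \<open>n\<close> together, matching the
  recursion of \<open>G\<close>.\<close>

definition wt_sum :: "nat \<Rightarrow> nat \<Rightarrow> R" where
  "wt_sum i n = descent_sum wt (of_nat i - of_nat n / 2) n"

lemma wt_sum_eq_0: "i < n \<Longrightarrow> wt_sum i n = 0"
  by (simp add: wt_sum_def descent_sum_eq_0)

lemma wt_sum_0_0 [simp]: "wt_sum 0 0 = 1"
  unfolding wt_sum_def by (subst descent_sum_rec) (simp add: descent_sum_eq_0)

lemma wt_sum_Suc:
  "wt_sum (Suc i) n = wt_sum (Suc i) (Suc n) + b_inv n * wt_sum i n +
    (if n > 0 then lam n * (b_inv (n - 1) * b_inv n) * wt_sum i (n - 1) else 0)"
proof -
  define d :: rat where "d = of_nat (Suc i) - of_nat n / 2"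
  have "d - 1/2 = of_nat (Suc i) - of_nat (Suc n) / 2" "d - 1 = of_nat i - of_nat n / 2"
    by (simp_all add: d_def field_simps)
  moreover have "d - 1/2 = of_nat i - of_nat (n - 1) / 2" if "n > 0"
    using that by (simp add: d_def of_nat_diff field_simps)
  ultimately have "descent_sum wt (d - 1/2) (n + 1) = wt_sum (Suc i) (Suc n)"
    "descent_sum wt (d - 1) n = wt_sum i n"
    "n > 0 \<Longrightarrow> descent_sum wt (d - 1/2) (n - 1) = wt_sum i (n - 1)"
    unfolding wt_sum_def by simp_all
  moreover have "wt_sum (Suc i) n = descent_sum wt d n"
    by (simp add: wt_sum_def d_def)
  moreover have "\<not> (d = 0 \<and> n = 0)"
    unfolding d_def by (metis diff_zero div_0 of_nat_0 of_nat_eq_0_iff nat.distinct(1))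
  ultimately show ?thesis
    using descent_sum_rec[of wt d n] by simp
qed

text \<open>Here \<open>m\<close> stands for \<open>- i - 1\<close>: NE and E steps lower
  \<open>m\<close>, SE steps keep it.\<close>

definition wt_bar_sum :: "nat \<Rightarrow> nat \<Rightarrow> R" where
  "wt_bar_sum m n = descent_sum wt_bar (of_nat m + of_nat n / 2) n"

text \<open>The distance \<open>n/2\<close> is the least possible from height \<open>n\<close>, so
  only the straight descent survives.\<close>

lemma wt_bar_sum_0:
  "wt_bar_sum 0 n = (if n = 0 then 1 else lam n * wt_bar_sum 0 (n - 1))"
proof -
  define d :: rat where "d = of_nat n / 2"
  have "d - 1/2 = of_nat 0 + of_nat (n - 1) / 2" if "n > 0"
    using that by (simp add: d_def of_nat_diff field_simps)
  then have "n > 0 \<Longrightarrow> descent_sum wt_bar (d - 1/2) (n - 1) = wt_bar_sum 0 (n - 1)"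
    by (simp only: wt_bar_sum_def)
  moreover have "wt_bar_sum 0 n = descent_sum wt_bar d n"
    by (simp add: wt_bar_sum_def d_def)
  moreover have "descent_sum wt_bar (d - 1/2) (n + 1) = 0" "descent_sum wt_bar (d - 1) n = 0"
    by (simp_all add: descent_sum_eq_0 d_def)
  moreover have "d = 0 \<longleftrightarrow> n = 0"
    by (simp add: d_def)
  ultimately show ?thesis
    using descent_sum_rec[of wt_bar d n] by simp
qed

lemma wt_bar_sum_Suc:
  "wt_bar_sum (Suc m) n = wt_bar_sum m (Suc n) + b_gen n * wt_bar_sum m n +
    (if n > 0 then lam n * wt_bar_sum (Suc m) (n - 1) else 0)"
proof -
  define d :: rat where "d = of_nat (Suc m) + of_nat n / 2"
  have "d - 1/2 = of_nat m + of_nat (Suc n) / 2" "d - 1 = of_nat m + of_nat n / 2"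
    by (simp_all add: d_def field_simps)
  moreover have "d - 1/2 = of_nat (Suc m) + of_nat (n - 1) / 2" if "n > 0"
    using that by (simp add: d_def of_nat_diff field_simps)
  ultimately have "descent_sum wt_bar (d - 1/2) (n + 1) = wt_bar_sum m (Suc n)"
    "descent_sum wt_bar (d - 1) n = wt_bar_sum m n"
    "n > 0 \<Longrightarrow> descent_sum wt_bar (d - 1/2) (n - 1) = wt_bar_sum (Suc m) (n - 1)"
    unfolding wt_bar_sum_def by simp_all
  moreover have "wt_bar_sum (Suc m) n = descent_sum wt_bar d n"
    by (simp add: wt_bar_sum_def d_def)
  moreover have "d > 0"
    unfolding d_def by (rule add_pos_nonneg) simp_all
  ultimately show ?thesis
    using descent_sum_rec[of wt_bar d n] by simp
qed

section \<open>The numbers \<open>G(i, n)\<close>\<close>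

definition laurent_moment :: "int \<Rightarrow> nat \<Rightarrow> R" where
  "laurent_moment i n =
    (if i \<ge> 0 then (- 1) ^ n * (\<Prod>k<n. b_gen k) * wt_sum (nat i) n
     else b_gen 0 * wt_bar_sum (nat (- i - 1)) n)"

lemma laurent_moment_0: "laurent_moment i 0 = \<mu> i"
proof (cases "i \<ge> 0")
  case True
  then show ?thesis
    by (simp add: laurent_moment_def \<mu>_def wt_sum_def descent_sum_def schroeder_paths_eq_descents)
next
  case False
  define m where "m = nat (- i - 1)"
  have m: "nat (- i) = Suc m" using False by (simp add: m_def)
  \<comment> \<open>Deleting the forced E step at height \<open>0\<close> shortens the path by one,
    whence the index \<open>- i - 1\<close>; its weight is the factor
    \<open>b_gen 0\<close>.\<close>
  have "{w \<in> schroeder_paths (nat (- i)). \<exists>v. w = E # v} = (#) E ` descents (of_nat m) 0"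
    unfolding m schroeder_paths_eq_descents by (subst descents_eq) auto
  then show ?thesis
    using False
    by (simp add: laurent_moment_def \<mu>_def wt_bar_sum_def descent_sum_def m_def[symmetric]
        sum.reindex sum_distrib_left)
qed

lemma laurent_moment_Suc:
  "laurent_moment i (Suc n) = laurent_moment (i - 1) n - b_gen n * laurent_moment i n
    - (if n > 0 then lam n * laurent_moment (i - 1) (n - 1) else 0)"
proof -
  consider (pos) "i > 0" | (zero) "i = 0" | (neg) "i < 0" by linarith
  then show ?thesis
  proof cases
    case pos
    then obtain j where i: "i = int (Suc j)"
      by (metis Suc_pred zero_less_imp_eq_int of_nat_0_less_iff)
    define B where "B = (\<Prod>k<n. b_gen k)"
    have inv: "b_gen n * (b_inv n * x) = x" for n x
      by (simp add: b_gen_b_inv mult.assoc[symmetric])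
    \<comment> \<open>An SE step leads to column \<open>n - 1\<close>, whose prefactor lacks
      \<open>b_gen (n - 1)\<close>; the \<open>b_inv (n - 1)\<close> in its weight accounts for
      that.\<close>
    have low: "B * (b_inv (n - 1) * x) = (\<Prod>k<n-1. b_gen k) * x" if "n > 0" for x
    proof -
      have "B = (\<Prod>k<n-1. b_gen k) * b_gen (n - 1)"
        using that unfolding B_def by (cases n) auto
      then show ?thesis by (simp add: mult.assoc inv)
    qed
    have sgn: "(- 1 :: R) ^ n = - ((- 1) ^ (n - 1))" if "n > 0"
      using that by (cases n) auto
    \<comment> \<open>Multiplying by \<open>b_gen n\<close> clears the \<open>b_inv n\<close> of E
      and SE steps and extends the prefactor of the NE term to column \<open>n + 1\<close>.\<close>
    have up: "b_gen n * wt_sum (Suc j) n = b_gen n * wt_sum (Suc j) (Suc n) + wt_sum j n +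
        (if n > 0 then lam n * (b_inv (n - 1) * wt_sum j (n - 1)) else 0)"
      by (subst wt_sum_Suc) (simp add: distrib_left inv mult.left_commute mult.assoc)
    have "b_gen n * laurent_moment i n = (- 1) ^ n * B * (b_gen n * wt_sum (Suc j) n)"
      unfolding i by (simp add: laurent_moment_def B_def algebra_simps del: of_nat_Suc)
    also have "\<dots> = - laurent_moment i (Suc n) + laurent_moment (i - 1) n
        + (if n > 0 then (- 1) ^ n * lam n * (B * (b_inv (n - 1) * wt_sum j (n - 1))) else 0)"
      unfolding up i
      by (simp add: laurent_moment_def B_def[symmetric] algebra_simps del: of_nat_Suc)
        (simp add: algebra_simps)
    also have "(if n > 0 then (- 1) ^ n * lam n * (B * (b_inv (n - 1) * wt_sum j (n - 1))) else 0)
        = - (if n > 0 then lam n * laurent_moment (i - 1) (n - 1) else 0)"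
    proof (cases "n > 0")
      case True
      have "(- 1) ^ n * lam n * (B * (b_inv (n - 1) * wt_sum j (n - 1)))
          = - ((- 1) ^ (n - 1)) * lam n * ((\<Prod>k<n-1. b_gen k) * wt_sum j (n - 1))"
        by (simp only: low[OF True] sgn[OF True])
      also have "\<dots> = - (lam n * laurent_moment (i - 1) (n - 1))"
        unfolding i by (simp add: laurent_moment_def ac_simps)
      finally show ?thesis using True by simp
    qed simp
    finally show ?thesis by (simp add: algebra_simps)
  next
    \<comment> \<open>Now \<open>i\<close> and \<open>i - 1\<close> fall into different branches of
      \<open>laurent_moment\<close>. The left side is \<open>0\<close>; on the right two
      \<open>b_gen 0\<close> cancel if \<open>n = 0\<close>, and the straight-descent recursion
      gives \<open>0\<close> if \<open>n > 0\<close>.\<close>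
    case zero
    then show ?thesis
      by (cases n) (simp_all add: laurent_moment_def wt_sum_eq_0 wt_bar_sum_0[of 0] wt_bar_sum_0[of "Suc _"]
          mult.left_commute)
  next
    case neg
    then obtain m where i: "i = - int (Suc m)"
      by (metis Suc_pred zero_less_imp_eq_int of_nat_0_less_iff neg_0_less_iff_less minus_minus)
    have "nat (- i - 1) = m" "nat (- (i - 1) - 1) = Suc m" using i by auto
    then show ?thesis
      using neg by (simp add: laurent_moment_def wt_bar_sum_Suc[of m n] algebra_simps)
  qed
qed

section \<open>Coefficients of the biorthogonal polynomials\<close>

text \<open>The coefficient of \<open>z^j\<close> in \<open>q_n\<close>. The guards encode
  \<open>q_{-1} = 0\<close> and the absence of negative exponents, where \<open>n - 1\<close> and
  \<open>j - 1\<close> would truncate.\<close>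

fun biorth_coeff :: "nat \<Rightarrow> nat \<Rightarrow> R" where
  "biorth_coeff 0 j = (if j = 0 then 1 else 0)"
| "biorth_coeff (Suc n) j =
    (if j = 0 then 0 else biorth_coeff n (j - 1)) - b_gen n * biorth_coeff n j
    - (if j = 0 \<or> n = 0 then 0 else lam n * biorth_coeff (n - 1) (j - 1))"

lemma biorth_coeff_eq_0: "n < j \<Longrightarrow> biorth_coeff n j = 0"
  by (induction n j rule: biorth_coeff.induct) auto

lemma biorth_coeff_diag: "biorth_coeff n n = 1"
  by (induction n) (auto simp: biorth_coeff_eq_0)

text \<open>The sum is \<open>\<L>(z^i q_n(1/z))\<close>. Both sides obey one recursion in
  \<open>n\<close>, reaching two steps back, hence strong induction; \<open>N\<close> stays free
  because a factor \<open>z\<close> shifts the summation range.\<close>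

lemma sum_biorth_coeff:
  "n \<le> N \<Longrightarrow> (\<Sum>j\<le>N. biorth_coeff n j * \<mu> (i - int j)) = laurent_moment i n"
proof (induction n arbitrary: N i rule: less_induct)
  case (less n)
  show ?case
  proof (cases n)
    case 0
    have "(\<Sum>j\<le>N. biorth_coeff 0 j * \<mu> (i - int j)) = (\<Sum>j\<in>{0}. biorth_coeff 0 j * \<mu> (i - int j))"
      by (rule sum.mono_neutral_right) auto
    then show ?thesis by (simp add: 0 laurent_moment_0)
  next
    case (Suc n')
    then obtain N' where N: "N = Suc N'" "n' \<le> N'"
      using less.prems by (cases N) auto
    \<comment> \<open>A factor \<open>z\<close> in the polynomial becomes \<open>1/z\<close> under
      the functional, so shifting coefficients lowers \<open>i\<close> by one.\<close>
    have shift: "(\<Sum>j\<le>N. (if j = 0 then 0 else g (j - 1)) * \<mu> (i - int j))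
        = (\<Sum>j\<le>N'. g j * \<mu> (i - 1 - int j))" for g
      unfolding N sum.atMost_Suc_shift by (simp add: algebra_simps)
    define e where "e j = (if n' = 0 then 0 else lam n' * biorth_coeff (n' - 1) j)" for j
    have "(\<Sum>j\<le>N. biorth_coeff n j * \<mu> (i - int j))
      = (\<Sum>j\<le>N. (if j = 0 then 0 else biorth_coeff n' (j - 1)) * \<mu> (i - int j))
        - b_gen n' * (\<Sum>j\<le>N. biorth_coeff n' j * \<mu> (i - int j))
        - (\<Sum>j\<le>N. (if j = 0 then 0 else e (j - 1)) * \<mu> (i - int j))"
      unfolding sum_distrib_left sum_subtractf[symmetric] Suc
      by (rule sum.cong) (auto simp: e_def algebra_simps)
    also have "(\<Sum>j\<le>N. (if j = 0 then 0 else biorth_coeff n' (j - 1)) * \<mu> (i - int j))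
        = laurent_moment (i - 1) n'"
      unfolding shift by (rule less.IH) (use N Suc in auto)
    also have "(\<Sum>j\<le>N. biorth_coeff n' j * \<mu> (i - int j)) = laurent_moment i n'"
      by (rule less.IH) (use N Suc in auto)
    also have "(\<Sum>j\<le>N. (if j = 0 then 0 else e (j - 1)) * \<mu> (i - int j))
        = (if n' > 0 then lam n' * laurent_moment (i - 1) (n' - 1) else 0)"
    proof (cases "n' > 0")
      case True
      have "(\<Sum>j\<le>N'. biorth_coeff (n' - 1) j * \<mu> (i - 1 - int j)) = laurent_moment (i - 1) (n' - 1)"
        by (rule less.IH) (use N Suc in auto)
      with True show ?thesis
        unfolding shift[of e] by (simp add: e_def mult.assoc sum_distrib_left[symmetric])
    qed (simp add: shift[of e] e_def)
    finally show ?thesis unfolding Suc laurent_moment_Suc[of i n'] .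
  qed
qed

section \<open>Divisibility of the columns and the diagonal entries\<close>

text \<open>A path from height \<open>n\<close> to \<open>0\<close> takes an SE step from each
  height \<open>k\<close> in \<open>1..n\<close>, and these weights factor out.\<close>

lemma prod_dvd_wt_sum: "(\<Prod>k=1..n. lam k * (b_inv (k - 1) * b_inv k)) dvd wt_sum i n"
\<comment> \<open>The measure is twice the horizontal distance, truncated at \<open>0\<close>; every
  first step shortens it.\<close>
proof (induction "2 * i - n" arbitrary: i n rule: less_induct)
  case less
  let ?c = "\<lambda>k. lam k * (b_inv (k - 1) * b_inv k)"
  show ?case
  proof (cases "i < n \<or> i = 0")
    case True
    then show ?thesis by (cases "i < n") (simp_all add: wt_sum_eq_0)
  next
    case False
    then obtain j where i: "i = Suc j" "n \<le> Suc j" by (cases i) auto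
    have 1: "(\<Prod>k=1..n. ?c k) dvd wt_sum (Suc j) (Suc n)"
    proof -
      \<comment> \<open>After an NE step the path descends from \<open>Suc n\<close>, so even a
        longer product divides.\<close>
      have "(\<Prod>k=1..Suc n. ?c k) dvd wt_sum (Suc j) (Suc n)"
        by (rule less) (use i in auto)
      moreover have "(\<Prod>k=1..Suc n. ?c k) = (\<Prod>k=1..n. ?c k) * ?c (Suc n)"
        by simp
      ultimately show ?thesis by (simp only: dvd_mult_left)
    qed
    have 2: "(\<Prod>k=1..n. ?c k) dvd wt_sum j n"
    proof (cases "n = Suc j")
      case True
      then show ?thesis by (simp add: wt_sum_eq_0)
    next
      case False
      then show ?thesis using less[of j n] i by auto
    qed
    have 3: "(\<Prod>k=1..n. ?c k) dvd (if n > 0 then ?c n * wt_sum j (n - 1) else 0)"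
    proof (cases n)
      case (Suc n')
      have "2 * j - n' < 2 * i - n" using i Suc by auto
      then have "(\<Prod>k=1..n'. ?c k) dvd wt_sum j n'" by (rule less)
      then have "?c n * (\<Prod>k=1..n'. ?c k) dvd ?c n * wt_sum j n'" by (rule mult_dvd_mono[OF dvd_refl])
      then show ?thesis using Suc by (simp add: mult.commute)
    qed simp
    show ?thesis unfolding i wt_sum_Suc[of j n] using 1 2 3 by (intro dvd_add dvd_mult)
  qed
qed

text \<open>The distance is again the minimal \<open>n/2\<close>, which leaves only the straight
  descent.\<close>

lemma wt_sum_diag: "wt_sum n n = (\<Prod>k=1..n. lam k * (b_inv (k - 1) * b_inv k))"
proof (induction n)
  case (Suc n)
  have "wt_sum (Suc n) (Suc n) = lam (Suc n) * (b_inv n * b_inv (Suc n)) * wt_sum n n"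
    by (subst wt_sum_Suc) (simp add: wt_sum_eq_0)
  with Suc show ?case by (simp add: mult.commute)
qed simp

text \<open>The prefactor of \<open>G\<close> cancels every \<open>b_inv (k - 1)\<close> in the SE
  weights.\<close>

lemma prod_b_gen_mult:
  "(\<Prod>k<n. b_gen k) * (\<Prod>k=1..n. lam k * (b_inv (k - 1) * b_inv k)) = (\<Prod>k=1..n. lam k * b_inv k)"
proof (induction n)
  case (Suc n)
  have "(\<Prod>k<Suc n. b_gen k) * (\<Prod>k=1..Suc n. lam k * (b_inv (k - 1) * b_inv k))
    = ((\<Prod>k<n. b_gen k) * (\<Prod>k=1..n. lam k * (b_inv (k - 1) * b_inv k)))
      * (lam (Suc n) * b_inv (Suc n)) * (b_gen n * b_inv n)"
    by (simp add: ac_simps)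
  then show ?case unfolding Suc by (simp add: b_gen_b_inv)
qed simp

lemma laurent_moment_eq_0: "i < n \<Longrightarrow> laurent_moment (int i) n = 0"
  by (simp add: laurent_moment_def wt_sum_eq_0)

lemma laurent_moment_diag:
  "laurent_moment (int n) n = (- 1) ^ n * (\<Prod>k=1..n. lam k * b_inv k)"
  by (simp add: laurent_moment_def wt_sum_diag mult.assoc prod_b_gen_mult del: One_nat_def)

lemma laurent_moment_diag_dvd: "laurent_moment (int n) n dvd laurent_moment (int i) n"
  by (auto simp: laurent_moment_def wt_sum_diag intro!: mult_dvd_mono prod_dvd_wt_sum
      simp del: One_nat_def)

section \<open>Unimodular factors and the normal form\<close>

lemma det_lower_unitriangular:
  fixes L :: "'a :: comm_ring_1 mat"
  assumes "L \<in> carrier_mat n n"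
    and "\<And>i j. i < j \<Longrightarrow> j < n \<Longrightarrow> L $$ (i, j) = 0" and "\<And>i. i < n \<Longrightarrow> L $$ (i, i) = 1"
  shows "det L = 1"
proof -
  have "diag_mat L = map (\<lambda>_. 1) [0..<n]"
    unfolding diag_mat_def using assms by (intro map_cong) auto
  then show ?thesis
    using det_lower_triangular[of n L] assms(1,2)
    by (simp add: map_replicate_const)
qed

text \<open>With determinant \<open>1\<close> the adjugate is an inverse, and multiplicativity gives
  it determinant \<open>1\<close> too.\<close>

lemma special_linear_inverse:
  assumes "L \<in> special_linear n"
  obtains P where "P \<in> special_linear n" "P * L = 1\<^sub>m n"
proof
  have L: "L \<in> carrier_mat n n" "det L = 1" using assms by (auto simp: special_linear_def)
  show *: "adj_mat L * L = 1\<^sub>m n"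
    using adj_mat(3)[OF L(1)] L(2) by (auto intro!: eq_matI)
  then have "det (adj_mat L) * det L = 1"
    using det_mult[OF adj_mat(1)[OF L(1)] L(1)] by simp
  then show "adj_mat L \<in> special_linear n"
    using L adj_mat(1)[OF L(1)] by (simp add: special_linear_def)
qed

theorem theorem6p1:
  fixes n :: nat
  shows "is_SSNF
    (mat (n + 1) (n + 1) (\<lambda>(i, j). \<mu> (int i - int j)))
    (mat (n + 1) (n + 1)
      (\<lambda>(i, j). if i = j then (- 1) ^ i * (\<Prod>k = 1..i. lam k * b_inv k) else 0))"
proof -
  define d where "d i = (- 1) ^ i * (\<Prod>k = 1..i. lam k * b_inv k)" for i
  define A where "A = mat (n + 1) (n + 1) (\<lambda>(i, j). \<mu> (int i - int j))"
  define D where "D = mat (n + 1) (n + 1) (\<lambda>(i, j). if i = j then d i else 0)"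
  \<comment> \<open>Column \<open>j\<close> holds the coefficients of \<open>q_j\<close>, so
    \<open>A * Q\<close> has the entries \<open>G(i, j)\<close>.\<close>
  define Q where "Q = mat (n + 1) (n + 1) (\<lambda>(i, j). biorth_coeff j i)"
  \<comment> \<open>The quotient is picked by cases, \<open>0\<close> above the diagonal and
    \<open>1\<close> on it, so that \<open>L\<close> is unitriangular by construction rather than by
    cancelling \<open>d j\<close>.\<close>
  have "\<exists>l. laurent_moment (int i) j = l * d j \<and> (i < j \<longrightarrow> l = 0) \<and> (i = j \<longrightarrow> l = 1)" for i j
    using laurent_moment_diag_dvd[of j i]
    by (cases i j rule: linorder_cases)
      (auto simp: laurent_moment_eq_0 laurent_moment_diag d_def mult.commute elim!: dvdE)
  then obtain l where l: "\<And>i j. laurent_moment (int i) j = l i j * d j"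
    "\<And>i j. i < j \<Longrightarrow> l i j = 0" "\<And>i. l i i = 1"
    by metis
  define L where "L = mat (n + 1) (n + 1) (\<lambda>(i, j). l i j)"
  have carrier: "A \<in> carrier_mat (n + 1) (n + 1)" "D \<in> carrier_mat (n + 1) (n + 1)"
    "Q \<in> carrier_mat (n + 1) (n + 1)" "L \<in> carrier_mat (n + 1) (n + 1)"
    by (auto simp: A_def D_def Q_def L_def)
  have "det L = 1"
    by (rule det_lower_unitriangular[OF carrier(4)]) (auto simp: L_def l)
  then obtain P where P: "P \<in> special_linear (n + 1)" "P * L = 1\<^sub>m (n + 1)"
    using special_linear_inverse[of L "n + 1"] carrier by (auto simp: special_linear_def)
  \<comment> \<open>\<open>Q\<close> is upper unitriangular, so its transpose fits the lower
    triangular criterion.\<close>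
  have "det (transpose_mat Q) = 1"
    by (rule det_lower_unitriangular[of _ "n + 1"])
      (auto simp: Q_def biorth_coeff_eq_0 biorth_coeff_diag)
  then have Q: "Q \<in> special_linear (n + 1)"
    using carrier det_transpose[OF carrier(3)] by (simp add: special_linear_def)
  have "A * Q = L * D"
  proof (rule eq_matI)
    fix i j assume "i < dim_row (L * D)" "j < dim_col (L * D)"
    then have ij: "i < n + 1" "j < n + 1" using carrier by auto
    \<comment> \<open>The bound \<open>n\<close> serves all columns at once, as
      \<open>sum_biorth_coeff\<close> allows any bound from \<open>j\<close> on.\<close>
    have "(A * Q) $$ (i, j) = (\<Sum>k\<le>n. biorth_coeff j k * \<mu> (int i - int k))"
      using ij by (simp add: A_def Q_def scalar_prod_def atLeast0LessThan lessThan_Suc_atMost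
          mult.commute del: sum.lessThan_Suc sum.atMost_Suc)
    also have "\<dots> = l i j * d j"
      using ij by (simp add: sum_biorth_coeff l)
    also have "\<dots> = (\<Sum>k\<in>{0..<n + 1}. l i k * (if k = j then d k else 0))"
      using ij by (simp add: if_distrib[of "\<lambda>x. _ * x"] sum.delta cong: if_cong del: sum.op_ivl_Suc)
    also have "\<dots> = (L * D) $$ (i, j)"
      using ij by (simp add: L_def D_def scalar_prod_def del: sum.op_ivl_Suc)
    finally show "(A * Q) $$ (i, j) = (L * D) $$ (i, j)" .
  qed (use carrier in auto)
  moreover have "P \<in> carrier_mat (n + 1) (n + 1)" using P by (simp add: special_linear_def)
  ultimately have "P * A * Q = P * L * D"
    using carrier by (simp add: assoc_mult_mat[of _ "n + 1" "n + 1" _ "n + 1" _ "n + 1"])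
  then have "P * A * Q = D"
    using carrier P(2) by simp
  moreover have "d j dvd d i" if "j \<le> i" for i j
  proof -
    have "(\<Prod>k = 1..j. lam k * b_inv k) dvd (\<Prod>k = 1..i. lam k * b_inv k)"
      using that by (intro prod_dvd_prod_subset) auto
    moreover have "(- 1 :: R) ^ j dvd (- 1) ^ i" using that by (rule le_imp_power_dvd)
    ultimately show ?thesis unfolding d_def by (rule mult_dvd_mono[rotated])
  qed
  ultimately have "is_SSNF A D"
    unfolding is_SSNF_def using P(1) Q carrier
    by (auto simp: diagonal_mat_def D_def)
  then show ?thesis unfolding A_def D_def d_def .
qed

end
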